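(* There is an absolute constant $c_0\le16$ such that, for all $r\in[0,T]$, $x\in\partial K$ and $y\in K$, $$\langle\nabla_x\Phi_r(x,y),\Theta_r\mathbf n(x)\rangle\ \ge\ \frac{2\cos2\theta_r}{\cos\theta_r}\,\langle x-y,\mathbf n(x)\rangle-c_0\,b_*\tan\theta_r\,|x-y|^2 .$$ Likewise, for all $r\in[0,T]$, $y\in\partial K$ and $x\in K$, $$\langle\nabla_y\Phi_r(x,y),\Theta_r\mathbf n(y)\rangle\ \ge\ \frac{2\cos2\theta_r}{\cos\theta_r}\,\langle y-x,\mathbf n(y)\rangle-c_0\,b_*\tan\theta_r\,|x-y|^2 .$$
   Context: $K\subset\mathbb R^2$ is a bounded closed convex set with nonempty interior, with $\operatorname{int}K=\{\psi<0\}$, $\partial K=\{\psi=0\}$ and $|\nabla\psi|=1$ on $\partial K$, where $\psi:\mathbb R^2\to\mathbb R$ is convex and, on a bounded open neighborhood $\mathcal V$ of $K$, of class $C^3$ with $a_\psi I\le D^2\psi\le b_\psi I$ and $\|D^3\psi\|\le b_\psi$ for constants $a_\psi>0$, $b_\psi\ge1$. $D_K:=\operatorname{diam}K$, $b_*:=b_\psi(1+b_\psi D_K)$. $\theta\in C^1([0,T];(0,\pi/2))$, $J=\begin{pmatrix}0&-1\\1&0\end{pmatrix}$, $\Theta_r=\cos\theta_r\,I+\sin\theta_r\,J$. Near $K$, $\mathbf n:=\nabla\psi$ (so $\mathbf n$ is the outward unit normal on $\partial K$), $\mathbf n_{x,y}:=\mathbf n(x)+\mathbf n(y)$, $P(x,y):=\langle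 x-y,\mathbf n_{x,y}\rangle$, $Q(x,y):=\langle x-y,J\mathbf n_{x,y}\rangle$, and $\Phi_r(x,y):=|x-y|^2-\frac12\tan\theta_r\,P(x,y)Q(x,y)$. "Absolute" means independent of all the data. *)

theory Defs
  imports "HOL-Analysis.Analysis"
begin

definition grad :: "('a::real_inner \<Rightarrow> real) \<Rightarrow> 'a \<Rightarrow> 'a" where
  "grad f x = (THE g. GDERIV f x :> g)"

text \<open>Frechet derivative as a bounded linear map. In its iterates the norm on \<^typ>\<open>'a \<Rightarrow>\<^sub>L 'b\<close>
  is the operator norm of the corresponding multilinear form.\<close>

definition fderiv :: "('a::real_normed_vector \<Rightarrow> 'b::real_normed_vector) \<Rightarrow> 'a \<Rightarrow> 'a \<Rightarrow>\<^sub>L 'b" where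
  "fderiv f x = Blinfun (frechet_derivative f (at x))"

definition C3_on :: "'a::real_normed_vector set \<Rightarrow> ('a \<Rightarrow> 'b::real_normed_vector) \<Rightarrow> bool" where
  "C3_on V f \<longleftrightarrow>
     (\<forall>x\<in>V. f differentiable (at x)) \<and>
     (\<forall>x\<in>V. fderiv f differentiable (at x)) \<and>
     (\<forall>x\<in>V. fderiv (fderiv f) differentiable (at x)) \<and>
     continuous_on V (fderiv (fderiv (fderiv f)))"

definition admissible_domain ::
  "(real^2) set \<Rightarrow> (real^2 \<Rightarrow> real) \<Rightarrow> (real^2) set \<Rightarrow> real \<Rightarrow> real \<Rightarrow> bool" where
  "admissible_domain K \<psi> V a b \<longleftrightarrow>
     bounded K \<and> closed K \<and> convex K \<and> interior K \<noteq> {} \<and>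
     convex_on UNIV \<psi> \<and>
     interior K = {x. \<psi> x < 0} \<and> frontier K = {x. \<psi> x = 0} \<and>
     (\<forall>x\<in>frontier K. norm (grad \<psi> x) = 1) \<and>
     open V \<and> bounded V \<and> K \<subseteq> V \<and> C3_on V \<psi> \<and>
     0 < a \<and> 1 \<le> b \<and>
     (\<forall>x\<in>V. \<forall>h. a * (norm h)\<^sup>2 \<le> fderiv (fderiv \<psi>) x h h \<and>
                fderiv (fderiv \<psi>) x h h \<le> b * (norm h)\<^sup>2) \<and>
     (\<forall>x\<in>V. norm (fderiv (fderiv (fderiv \<psi>)) x) \<le> b)"

text \<open>Membership in \<open>C\<^sup>1([0,T];(0,\<pi>/2))\<close>, with one-sided derivatives at the end points; the
  library's \<^const>\<open>C1_differentiable_on\<close> would require two-sided derivatives there.\<close>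

definition admissible_angle :: "real \<Rightarrow> (real \<Rightarrow> real) \<Rightarrow> bool" where
  "admissible_angle T \<theta> \<longleftrightarrow>
     (\<exists>\<theta>'. (\<forall>r\<in>{0..T}. (\<theta> has_real_derivative \<theta>' r) (at r within {0..T})) \<and>
           continuous_on {0..T} \<theta>') \<and>
     (\<forall>r\<in>{0..T}. 0 < \<theta> r \<and> \<theta> r < pi / 2)"

definition bstar :: "(real^2) set \<Rightarrow> real \<Rightarrow> real" where
  "bstar K b = b * (1 + b * diameter K)"

definition Jmat :: "real^2^2" where
  "Jmat = vector [vector [0, -1], vector [1, 0]]"

text \<open>In what follows \<open>t\<close> stands for the angle \<open>\<theta>\<^sub>r\<close>.\<close>

definition Theta :: "real \<Rightarrow> real^2^2" where
  "Theta t = cos t *\<^sub>R mat 1 + sin t *\<^sub>R Jmat"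

definition nsum :: "(real^2 \<Rightarrow> real) \<Rightarrow> real^2 \<Rightarrow> real^2 \<Rightarrow> real^2" where
  "nsum \<psi> x y = grad \<psi> x + grad \<psi> y"

definition Pfun :: "(real^2 \<Rightarrow> real) \<Rightarrow> real^2 \<Rightarrow> real^2 \<Rightarrow> real" where
  "Pfun \<psi> x y = (x - y) \<bullet> nsum \<psi> x y"

definition Qfun :: "(real^2 \<Rightarrow> real) \<Rightarrow> real^2 \<Rightarrow> real^2 \<Rightarrow> real" where
  "Qfun \<psi> x y = (x - y) \<bullet> (Jmat *v nsum \<psi> x y)"

definition Phi :: "(real^2 \<Rightarrow> real) \<Rightarrow> real \<Rightarrow> real^2 \<Rightarrow> real^2 \<Rightarrow> real" where
  "Phi \<psi> t x y = (norm (x - y))\<^sup>2 - 1/2 * tan t * Pfun \<psi> x y * Qfun \<psi> x y"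

end

theory Submission imports Defs begin

text \<open>
  Write \<open>w = x - y\<close>, \<open>n = \<nabla>\<psi>(x)\<close>, \<open>N = n\<^bsub>x,y\<^esub>\<close>, \<open>H = D\<^sup>2\<psi>(x)\<close>, and \<open>v = \<Theta>n = cos \<theta> n + sin \<theta> Jn\<close>, a unit
  vector. The derivative of \<open>\<Phi>\<close> at \<open>x\<close> in the direction \<open>v\<close> is
  \<open>2\<langle>w,v\<rangle> - \<onehalf> tan \<theta> ((\<langle>v,N\<rangle> + \<langle>w,Hv\<rangle>) Q + P (\<langle>v,JN\<rangle> + \<langle>w,JHv\<rangle>))\<close>.
  If \<open>N\<close> is replaced by \<open>2n\<close> and the terms with \<open>H\<close> are dropped, then \<open>P\<close>, \<open>Q\<close>, \<open>\<langle>v,N\<rangle>\<close>, \<open>\<langle>v,JN\<rangle>\<close>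
  become \<open>2\<langle>w,n\<rangle>\<close>, \<open>2\<langle>w,Jn\<rangle>\<close>, \<open>2 cos \<theta>\<close>, \<open>2 sin \<theta>\<close>. The coefficient of \<open>\<langle>w,Jn\<rangle>\<close> then vanishes, which is
  what the rotation by \<open>\<theta>\<close> is for, and that of \<open>\<langle>w,n\<rangle>\<close> is \<open>2 cos \<theta> - 2 sin\<^sup>2 \<theta> / cos \<theta>\<close>, that is,
  \<open>2 cos 2\<theta> / cos \<theta>\<close>. The leading term is thus exact, and only the two replacements have to be paid for.

  Both cost terms of order \<open>b |w|\<^sup>2\<close>: the Hessian bound gives \<open>|Hv| \<le> b\<close> and, by the mean value inequality
  along the segment from \<open>x\<close> to \<open>y\<close>, \<open>|N - 2n| = |\<nabla>\<psi>(y) - \<nabla>\<psi>(x)| \<le> b |w|\<close>. Since moreover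
  \<open>|N| \<le> 2 + b D\<^sub>K\<close>, the total is at most \<open>6 b\<^sub>* tan \<theta> |w|\<^sup>2\<close> (lemma \<open>rotated_normal_remainder\<close>).

  The Hessian is controlled only through its quadratic form, so the operator bound needs its symmetry
  (lemmas \<open>hessian_symmetric\<close> and \<open>norm_le_of_quadratic_form\<close>). The second inequality is the first one with
  the two points exchanged, because \<open>P\<close> and \<open>Q\<close> are antisymmetric and so \<open>\<Phi>\<close> is symmetric.
\<close>

section \<open>Gradients\<close>

lemma fderiv_works:
  assumes "f differentiable (at x)"
  shows "(f has_derivative blinfun_apply (fderiv f x)) (at x)"
proof -
  have "(f has_derivative frechet_derivative f (at x)) (at x)"
    using assms by (simp only: frechet_derivative_works)
  moreover from this have "blinfun_apply (fderiv f x) = frechet_derivative f (at x)"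
    unfolding fderiv_def
    by (intro bounded_linear_Blinfun_apply has_derivative_bounded_linear)
  ultimately show ?thesis by simp
qed

lemma linear_functional_eq_inner:
  fixes f :: "'a::euclidean_space \<Rightarrow> real"
  assumes "linear f"
  shows "f h = (\<Sum>i\<in>Basis. f i *\<^sub>R i) \<bullet> h"
proof -
  have "f h = f (\<Sum>i\<in>Basis. (h \<bullet> i) *\<^sub>R i)"
    by (simp add: euclidean_representation)
  also have "\<dots> = (\<Sum>i\<in>Basis. (h \<bullet> i) * f i)"
    using assms by (simp add: linear_sum linear_cmul)
  also have "\<dots> = (\<Sum>i\<in>Basis. f i *\<^sub>R i) \<bullet> h"
    unfolding inner_sum_left by (rule sum.cong) (simp_all add: inner_commute mult.commute)
  finally show ?thesis .
qed

text \<open>In finite dimension every derivative is represented by a vector, and derivatives are unique, so the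
  definite description in the definition of the gradient denotes that vector.\<close>

lemma grad_eq_sum_Basis:
  fixes f :: "'a::euclidean_space \<Rightarrow> real"
  assumes "(f has_derivative f') (at x)"
  shows "grad f x = (\<Sum>i\<in>Basis. f' i *\<^sub>R i)"
proof -
  define g where "g = (\<Sum>i\<in>Basis. f' i *\<^sub>R i)"
  have lin: "linear f'"
    using assms has_derivative_bounded_linear bounded_linear.linear by blast
  have "f' h = h \<bullet> g" for h
    unfolding g_def by (subst inner_commute, rule linear_functional_eq_inner[OF lin])
  then have "f' = (\<lambda>h. h \<bullet> g)" by (rule ext)
  with assms have g: "(f has_derivative (\<lambda>h. h \<bullet> g)) (at x)" by (simp only:)
  have "(THE g. GDERIV f x :> g) = g"
  proof (rule the_equality)
    show "GDERIV f x :> g"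
      unfolding gderiv_def by (rule g)
  next
    fix g' assume "GDERIV f x :> g'"
    then have "(\<lambda>h. h \<bullet> g') = (\<lambda>h. h \<bullet> g)"
      unfolding gderiv_def by (rule has_derivative_unique[OF _ g])
    then have "h \<bullet> g' = h \<bullet> g" for h by (rule fun_cong)
    then have "\<forall>h. h \<bullet> g' = h \<bullet> g" by (rule allI)
    then show "g' = g" by (rule iffD1[OF vector_eq_ldot])
  qed
  then show ?thesis
    unfolding grad_def g_def .
qed

lemma inner_grad:
  fixes f :: "'a::euclidean_space \<Rightarrow> real"
  assumes "(f has_derivative f') (at x)"
  shows "grad f x \<bullet> h = f' h"
proof -
  have "linear f'"
    using assms has_derivative_bounded_linear bounded_linear.linear by blast
  from linear_functional_eq_inner[OF this, symmetric] show ?thesis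
    unfolding grad_eq_sum_Basis[OF assms] .
qed

section \<open>The Hessian\<close>

text \<open>The second difference of \<open>f\<close> along \<open>s u\<close> and \<open>s v\<close> is, by the mean value theorem in the direction \<open>v\<close>,
  \<open>s\<close> times a difference of gradients paired with \<open>v\<close>, hence \<open>s\<^sup>2 \<langle>H u, v\<rangle>\<close> up to an error of order \<open>e s\<^sup>2\<close>.\<close>

lemma second_difference_estimate:
  fixes f :: "'a::euclidean_space \<Rightarrow> real"
  assumes f: "\<And>z. z \<in> ball x d \<Longrightarrow> (f has_derivative (\<lambda>h. h \<bullet> g z)) (at z)"
    and H: "linear H"
    and g: "\<And>z. z \<in> ball x d \<Longrightarrow> norm (g z - g x - H (z - x)) \<le> e * norm (z - x)"
    and s: "0 < s" "s * (norm u + norm v) < d" and e: "0 \<le> e"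
  shows "\<bar>f (x + s *\<^sub>R u + s *\<^sub>R v) - f (x + s *\<^sub>R u) - f (x + s *\<^sub>R v) + f x - s\<^sup>2 * (H u \<bullet> v)\<bar>
           \<le> 2 * e * s\<^sup>2 * (norm u + norm v)\<^sup>2"
proof -
  define \<phi> where "\<phi> = (\<lambda>\<tau>. f (x + s *\<^sub>R u + \<tau> *\<^sub>R v) - f (x + \<tau> *\<^sub>R v))"
  have small: "norm (r *\<^sub>R u + \<tau> *\<^sub>R v) \<le> s * (norm u + norm v)"
    if "0 \<le> r" "r \<le> s" "0 \<le> \<tau>" "\<tau> \<le> s" for r \<tau>
  proof -
    have "norm (r *\<^sub>R u + \<tau> *\<^sub>R v) \<le> r * norm u + \<tau> * norm v"
      using that norm_triangle_ineq[of "r *\<^sub>R u" "\<tau> *\<^sub>R v"] by simp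
    also have "\<dots> \<le> s * norm u + s * norm v"
      using that by (intro add_mono mult_right_mono) auto
    finally show ?thesis by (simp add: algebra_simps)
  qed
  have inball: "x + (r *\<^sub>R u + \<tau> *\<^sub>R v) \<in> ball x d"
    if "0 \<le> r" "r \<le> s" "0 \<le> \<tau>" "\<tau> \<le> s" for r \<tau>
    using small[OF that] s(2) by (simp only: mem_ball dist_norm norm_minus_commute[of x]) simp
  define D where "D = (\<lambda>\<tau>. v \<bullet> g (x + (s *\<^sub>R u + \<tau> *\<^sub>R v)) - v \<bullet> g (x + (0 *\<^sub>R u + \<tau> *\<^sub>R v)))"
  have deriv: "(\<phi> has_real_derivative D \<tau>) (at \<tau>)" if \<tau>: "0 \<le> \<tau>" "\<tau> \<le> s" for \<tau>
  proof -
    have "((\<lambda>\<tau>. f (x + (r *\<^sub>R u + \<tau> *\<^sub>R v))) has_derivative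
             (\<lambda>k. (k *\<^sub>R v) \<bullet> g (x + (r *\<^sub>R u + \<tau> *\<^sub>R v)))) (at \<tau>)" if r: "0 \<le> r" "r \<le> s" for r
      by (rule has_derivative_compose[where f = "\<lambda>\<tau>. x + (r *\<^sub>R u + \<tau> *\<^sub>R v)",
            OF _ f[OF inball[OF r \<tau>]]])
         (auto intro!: derivative_eq_intros)
    from has_derivative_diff[OF this[of s] this[of 0]] s
    have "(\<phi> has_derivative (\<lambda>k. (k *\<^sub>R v) \<bullet> g (x + (s *\<^sub>R u + \<tau> *\<^sub>R v))
             - (k *\<^sub>R v) \<bullet> g (x + (0 *\<^sub>R u + \<tau> *\<^sub>R v)))) (at \<tau>)"
      unfolding \<phi>_def by (simp add: add.assoc)
    then show ?thesis
      unfolding has_field_derivative_def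
      by (rule has_derivative_eq_rhs) (simp add: fun_eq_iff D_def left_diff_distrib right_diff_distrib)
  qed
  obtain \<xi> where \<xi>: "0 < \<xi>" "\<xi> < s" and mv: "\<phi> s - \<phi> 0 = (s - 0) * D \<xi>"
    using MVT2[OF s(1), of \<phi> D] deriv by blast
  define z1 where "z1 = x + (s *\<^sub>R u + \<xi> *\<^sub>R v)"
  define z2 where "z2 = x + (0 *\<^sub>R u + \<xi> *\<^sub>R v)"
  define B where "B = s * (norm u + norm v)"
  have z: "z1 \<in> ball x d" "z2 \<in> ball x d" "norm (z1 - x) \<le> B" "norm (z2 - x) \<le> B"
    using inball[of s \<xi>] inball[of 0 \<xi>] small[of s \<xi>] small[of 0 \<xi>] \<xi> s
    unfolding z1_def z2_def B_def by auto
  have "norm (g z1 - g x - H (z1 - x)) \<le> e * B" "norm (g z2 - g x - H (z2 - x)) \<le> e * B"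
    using g[OF z(1)] g[OF z(2)] mult_left_mono[OF z(3) e] mult_left_mono[OF z(4) e]
    by linarith+
  moreover have "norm (g z1 - g z2 - s *\<^sub>R H u)
      \<le> norm (g z1 - g x - H (z1 - x)) + norm (g z2 - g x - H (z2 - x))"
  proof -
    have "g z1 - g z2 - s *\<^sub>R H u = (g z1 - g x - H (z1 - x)) - (g z2 - g x - H (z2 - x))"
      using H by (simp add: z1_def z2_def linear_add linear_cmul)
    then show ?thesis by (simp only: norm_triangle_ineq4)
  qed
  ultimately have gd: "norm (g z1 - g z2 - s *\<^sub>R H u) \<le> 2 * (e * B)"
    by linarith
  have "\<phi> s - \<phi> 0 - s\<^sup>2 * (H u \<bullet> v) = s * (v \<bullet> (g z1 - g z2 - s *\<^sub>R H u))"
    unfolding mv D_def z1_def[symmetric] z2_def[symmetric]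
    by (simp add: inner_diff_right inner_commute[of v "H u"] power2_eq_square right_diff_distrib)
  then have "\<bar>\<phi> s - \<phi> 0 - s\<^sup>2 * (H u \<bullet> v)\<bar> = s * \<bar>v \<bullet> (g z1 - g z2 - s *\<^sub>R H u)\<bar>"
    using s by (simp add: abs_mult)
  also have "\<dots> \<le> s * (norm v * (2 * (e * B)))"
  proof -
    have "norm v * norm (g z1 - g z2 - s *\<^sub>R H u) \<le> norm v * (2 * (e * B))"
      by (rule mult_left_mono[OF gd norm_ge_zero])
    then show ?thesis
      using s(1) Cauchy_Schwarz_ineq2[of v "g z1 - g z2 - s *\<^sub>R H u"]
      by (meson less_imp_le mult_left_mono order_trans)
  qed
  also have "\<dots> \<le> s * ((norm u + norm v) * (2 * (e * B)))"
    using s e by (intro mult_left_mono mult_right_mono) (auto simp: B_def)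
  also have "\<dots> = 2 * e * s\<^sup>2 * (norm u + norm v)\<^sup>2"
    unfolding B_def power2_eq_square by (simp only: mult.assoc mult.commute mult.left_commute)
  finally show ?thesis
    by (simp add: \<phi>_def diff_diff_eq2)
qed

text \<open>The second difference is symmetric in \<open>u\<close> and \<open>v\<close>, so its two expansions agree to leading order.\<close>

lemma hessian_symmetric:
  fixes f :: "'a::euclidean_space \<Rightarrow> real"
  assumes V: "open V" "x \<in> V"
    and f: "\<And>z. z \<in> V \<Longrightarrow> (f has_derivative (\<lambda>h. h \<bullet> g z)) (at z)"
    and gH: "(g has_derivative H) (at x)"
  shows "H u \<bullet> v = H v \<bullet> u"
proof (rule ccontr)
  assume ne: "H u \<bullet> v \<noteq> H v \<bullet> u"
  have H: "linear H"
    using gH has_derivative_bounded_linear bounded_linear.linear by blast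
  define M where "M = (norm u + norm v)\<^sup>2"
  have "u \<noteq> 0" using ne H by (auto simp: linear_0)
  then have nz: "0 < norm u + norm v" by (intro add_pos_nonneg) auto
  then have M: "0 < M" by (simp add: M_def)
  \<comment> \<open>each expansion is off by at most \<open>2 e s\<^sup>2 M\<close>, so two of them leave \<open>4 e M\<close>; any factor above 4 will do\<close>
  define e where "e = \<bar>H u \<bullet> v - H v \<bullet> u\<bar> / (5 * M)"
  have e: "0 < e" using ne M by (simp add: e_def)
  obtain d1 where d1: "0 < d1"
      "\<And>z. norm (z - x) < d1 \<Longrightarrow> norm (g z - g x - H (z - x)) \<le> e * norm (z - x)"
    using gH e unfolding has_derivative_at_alt by blast
  obtain d2 where d2: "0 < d2" "ball x d2 \<subseteq> V"
    using V open_contains_ball by blast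
  define d where "d = min d1 d2"
  have d: "0 < d" using d1 d2 by (simp add: d_def)
  have fd: "\<And>z. z \<in> ball x d \<Longrightarrow> (f has_derivative (\<lambda>h. h \<bullet> g z)) (at z)"
    using f d2(2) by (auto simp: d_def)
  have gd: "\<And>z. z \<in> ball x d \<Longrightarrow> norm (g z - g x - H (z - x)) \<le> e * norm (z - x)"
    using d1(2) by (auto simp: d_def dist_norm norm_minus_commute)
  define s where "s = d / (2 * (norm u + norm v))"
  have s: "0 < s" using d nz by (simp add: s_def)
  have "s * (norm u + norm v) = d / 2" using nz by (simp add: s_def field_simps del: distrib_left_numeral)
  then have sd: "s * (norm u + norm v) < d" using d by simp
  have s2: "0 < s\<^sup>2" using s by simp
  have swap: "x + s *\<^sub>R v + s *\<^sub>R u = x + s *\<^sub>R u + s *\<^sub>R v" "norm v + norm u = norm u + norm v"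
    by simp_all
  have sd': "s * (norm v + norm u) < d" using sd by (simp only: swap)
  have "\<bar>s\<^sup>2 * (H u \<bullet> v) - s\<^sup>2 * (H v \<bullet> u)\<bar> \<le> 4 * e * s\<^sup>2 * M"
    using second_difference_estimate[OF fd H gd s sd less_imp_le[OF e]]
      second_difference_estimate[OF fd H gd s sd' less_imp_le[OF e], unfolded swap]
    unfolding M_def by linarith
  then have "s\<^sup>2 * \<bar>H u \<bullet> v - H v \<bullet> u\<bar> \<le> s\<^sup>2 * (4 * e * M)"
    unfolding right_diff_distrib[symmetric] abs_mult by (simp add: ac_simps)
  then have "\<bar>H u \<bullet> v - H v \<bullet> u\<bar> \<le> 4 * e * M"
    using s2 by (rule mult_left_le_imp_le)
  moreover have "\<bar>H u \<bullet> v - H v \<bullet> u\<bar> = 5 * e * M"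
    using M by (simp add: e_def)
  ultimately show False
    using mult_pos_pos[OF e M] by linarith
qed

text \<open>Polarisation: \<open>4\<langle>Hu,v\<rangle>\<close> is the difference of the quadratic form at \<open>u + v\<close> and at \<open>u - v\<close>, of
  which positivity lets the second be dropped. This is applied to the multiple \<open>v\<close> of \<open>Hu\<close> that has the length of \<open>u\<close>.\<close>

lemma norm_le_of_quadratic_form:
  fixes H :: "'a::real_inner \<Rightarrow> 'a"
  assumes H: "linear H" and sym: "\<And>u v. H u \<bullet> v = H v \<bullet> u"
    and lo: "\<And>h. 0 \<le> H h \<bullet> h" and up: "\<And>h. H h \<bullet> h \<le> b * (norm h)\<^sup>2"
    and b: "0 \<le> b"
  shows "norm (H u) \<le> b * norm u"
proof (cases "H u = 0 \<or> u = 0")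
  case True
  then show ?thesis using b H by (auto simp: linear_0)
next
  case False
  define v where "v = (norm u / norm (H u)) *\<^sub>R H u"
  have nv: "norm v = norm u" using False by (simp add: v_def)
  have "4 * (H u \<bullet> v) = H (u + v) \<bullet> (u + v) - H (u - v) \<bullet> (u - v)"
    using sym[of v u] by (simp add: linear_add[OF H] linear_diff[OF H] inner_simps)
  also have "\<dots> \<le> b * (norm (u + v))\<^sup>2"
    using up[of "u + v"] lo[of "u - v"] by linarith
  also have "\<dots> \<le> b * (2 * norm u)\<^sup>2"
    using norm_triangle_ineq[of u v] nv b by (intro mult_left_mono power_mono) auto
  finally have "H u \<bullet> v \<le> b * norm u * norm u"
    by (simp add: power2_eq_square)
  moreover have "H u \<bullet> v = norm (H u) * norm u"
    using False by (simp add: v_def dot_square_norm power2_eq_square)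
  ultimately show ?thesis
    using False by simp
qed

lemma admissible_domain_hessian:
  assumes adm: "admissible_domain K \<psi> V a b" and x: "x \<in> V"
  obtains H where "(grad \<psi> has_derivative H) (at x)" "\<And>h. norm (H h) \<le> b * norm h"
proof -
  have V: "open V" and b: "1 \<le> b" and a: "0 < a" and C3: "C3_on V \<psi>"
    and form: "\<And>h. a * (norm h)\<^sup>2 \<le> fderiv (fderiv \<psi>) x h h"
      "\<And>h. fderiv (fderiv \<psi>) x h h \<le> b * (norm h)\<^sup>2"
    using adm x unfolding admissible_domain_def by blast+
  have d1: "(\<psi> has_derivative blinfun_apply (fderiv \<psi> z)) (at z)" if "z \<in> V" for z
    using C3 that fderiv_works unfolding C3_on_def by blast
  have d2: "(fderiv \<psi> has_derivative blinfun_apply (fderiv (fderiv \<psi>) x)) (at x)"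
    using C3 x fderiv_works unfolding C3_on_def by blast
  define H where "H = (\<lambda>h. \<Sum>i\<in>Basis. fderiv (fderiv \<psi>) x h i *\<^sub>R i)"
  have "((\<lambda>z. \<Sum>i\<in>Basis. fderiv \<psi> z i *\<^sub>R i) has_derivative H) (at x)"
    unfolding H_def by (auto intro!: derivative_eq_intros d2)
  then have gH: "(grad \<psi> has_derivative H) (at x)"
    by (rule has_derivative_transform_within_open[OF _ V x])
       (simp add: grad_eq_sum_Basis[OF d1])
  have Hin: "H h \<bullet> k = fderiv (fderiv \<psi>) x h k" for h k
    unfolding H_def
    by (rule linear_functional_eq_inner[symmetric])
       (rule bounded_linear.linear[OF blinfun.bounded_linear_right])
  have "(\<psi> has_derivative (\<lambda>h. h \<bullet> grad \<psi> z)) (at z)" if "z \<in> V" for z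
    using d1[OF that] inner_grad[OF d1[OF that]] by (simp add: inner_commute)
  then have sym: "H u \<bullet> v = H v \<bullet> u" for u v
    using hessian_symmetric[OF V x _ gH] by blast
  have "norm (H h) \<le> b * norm h" for h
  proof (rule norm_le_of_quadratic_form[OF _ sym])
    show "linear H" using gH has_derivative_bounded_linear bounded_linear.linear by blast
    show "0 \<le> H h \<bullet> h" for h
      using order_trans[OF _ form(1)[of h]] a by (simp add: Hin)
  qed (use form b in \<open>auto simp: Hin\<close>)
  then show thesis using gH that by blast
qed

lemma admissible_domain_grad_lipschitz:
  assumes adm: "admissible_domain K \<psi> V a b" and xy: "x \<in> K" "y \<in> K"
  shows "norm (grad \<psi> x - grad \<psi> y) \<le> b * norm (x - y)"
proof -
  have K: "convex K" "K \<subseteq> V"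
    using adm unfolding admissible_domain_def by auto
  have "\<forall>z. \<exists>H. z \<in> K \<longrightarrow> (grad \<psi> has_derivative H) (at z) \<and> (\<forall>h. norm (H h) \<le> b * norm h)"
    using admissible_domain_hessian[OF adm] K(2) by (metis subsetD)
  then obtain H where H: "\<And>z. z \<in> K \<Longrightarrow> (grad \<psi> has_derivative H z) (at z)"
      "\<And>z h. z \<in> K \<Longrightarrow> norm (H z h) \<le> b * norm h"
    by metis
  show ?thesis
  proof (rule differentiable_bound[OF K(1) _ _ xy, where f' = H])
    show "(grad \<psi> has_derivative H z) (at z within K)" if "z \<in> K" for z
      using H(1)[OF that] by (rule has_derivative_at_withinI)
    show "onorm (H z) \<le> b" if "z \<in> K" for z
      using H(2)[OF that] by (rule onorm_le)
  qed
qed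

section \<open>The rotated normal\<close>

lemma Jmat_nth: "(Jmat *v x) $ 1 = - x $ 2" "(Jmat *v x) $ 2 = x $ 1"
  by (simp_all add: Jmat_def matrix_vector_mult_def sum_2)

lemma inner_Jmat_Jmat: "(Jmat *v x) \<bullet> (Jmat *v y) = x \<bullet> y"
  by (simp add: inner_vec_def sum_2 Jmat_nth)

lemma norm_Jmat: "norm (Jmat *v x) = norm x"
  by (simp add: norm_eq_sqrt_inner inner_Jmat_Jmat)

lemma inner_Jmat_self: "x \<bullet> (Jmat *v x) = 0"
  by (simp add: inner_vec_def sum_2 Jmat_nth)

lemma Theta_mult: "Theta t *v x = cos t *\<^sub>R x + sin t *\<^sub>R (Jmat *v x)"
  by (simp add: Theta_def matrix_vector_mult_add_rdistrib scaleR_matrix_vector_assoc[symmetric])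

lemma norm_Theta: "norm (Theta t *v x) = norm x"
proof -
  have "(norm (Theta t *v x))\<^sup>2 = cos t * cos t * (norm x)\<^sup>2 + sin t * sin t * (norm x)\<^sup>2"
    unfolding Theta_mult dot_square_norm[symmetric] inner_add_left inner_add_right
      inner_scaleR_left inner_scaleR_right inner_Jmat_Jmat
    by (simp add: inner_commute[of "Jmat *v x" x] inner_Jmat_self)
  also have "\<dots> = ((cos t)\<^sup>2 + (sin t)\<^sup>2) * (norm x)\<^sup>2"
    by (simp only: power2_eq_square distrib_right)
  finally show ?thesis by simp
qed

section \<open>The derivative of Phi in the direction of the rotated normal\<close>

lemma Phi_commute: "Phi \<psi> t x y = Phi \<psi> t y x"
proof -
  have "x - y = - (y - x)" by simp
  then have "Pfun \<psi> x y = - Pfun \<psi> y x" "Qfun \<psi> x y = - Qfun \<psi> y x"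
    unfolding Pfun_def Qfun_def nsum_def by (simp_all only: inner_minus_left add.commute)
  then show ?thesis by (simp add: Phi_def norm_minus_commute)
qed

lemma has_derivative_Phi:
  assumes H: "(grad \<psi> has_derivative H) (at x)"
  shows "((\<lambda>z. Phi \<psi> t z y) has_derivative
    (\<lambda>v. 2 * ((x - y) \<bullet> v)
       - 1/2 * tan t * ((v \<bullet> nsum \<psi> x y + (x - y) \<bullet> H v) * Qfun \<psi> x y
           + Pfun \<psi> x y * (v \<bullet> (Jmat *v nsum \<psi> x y) + (x - y) \<bullet> (Jmat *v H v))))) (at x)"
proof -
  have J: "((\<lambda>z. Jmat *v F z) has_derivative (\<lambda>v. Jmat *v F' v)) (at x)"
    if "(F has_derivative F') (at x)" for F F' :: "real^2 \<Rightarrow> real^2"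
    by (rule bounded_linear.has_derivative[OF matrix_vector_mul_bounded_linear that])
  have N: "((\<lambda>z. grad \<psi> z + grad \<psi> y) has_derivative H) (at x)"
    using H by (auto intro!: derivative_eq_intros)
  have eq: "(\<lambda>z. Phi \<psi> t z y) = (\<lambda>z. (z - y) \<bullet> (z - y) - 1/2 * tan t *
      (((z - y) \<bullet> (grad \<psi> z + grad \<psi> y)) * ((z - y) \<bullet> (Jmat *v (grad \<psi> z + grad \<psi> y)))))"
    by (simp add: Phi_def Pfun_def Qfun_def nsum_def dot_square_norm fun_eq_iff)
  show ?thesis
    unfolding eq Pfun_def Qfun_def nsum_def
    by (rule derivative_eq_intros N J[OF N] refl)+
       (simp add: fun_eq_iff inner_commute algebra_simps)
qed

text \<open>Each product is compared with its value for \<open>N = 2n\<close>; replacing one factor at a time costs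
  \<open>b |w|\<^sup>2 (M + 2)\<close>, where \<open>M\<close> bounds \<open>|N|\<close>, and each term that contains \<open>k = Hv\<close> costs \<open>M b |w|\<^sup>2\<close>.\<close>

lemma rotated_normal_remainder:
  fixes w n N k :: "real^2"
  assumes n: "norm n = 1" and N: "norm (N - 2 *\<^sub>R n) \<le> b * norm w"
    and k: "norm k \<le> b" and b: "0 \<le> b" and w: "norm w \<le> D"
    and t: "0 < t" "t < pi / 2"
  defines "v \<equiv> Theta t *v n"
  shows "2 * (w \<bullet> v) - 1/2 * tan t * ((v \<bullet> N + w \<bullet> k) * (w \<bullet> (Jmat *v N))
           + (w \<bullet> N) * (v \<bullet> (Jmat *v N) + w \<bullet> (Jmat *v k)))
         \<ge> 2 * cos (2 * t) / cos t * (w \<bullet> n) - 6 * (b * (1 + b * D)) * tan t * (norm w)\<^sup>2"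
proof -
  define c s p q where "c = cos t" and "s = sin t" and "p = w \<bullet> n" and "q = w \<bullet> (Jmat *v n)"
  define P Q A B where "P = w \<bullet> N" and "Q = w \<bullet> (Jmat *v N)"
    and "A = v \<bullet> N" and "B = v \<bullet> (Jmat *v N)"
  define d M where "d = norm w" and "M = 2 + b * D"
  have c: "0 < c"
    using t by (simp add: c_def cos_gt_zero_pi)
  have nn: "n \<bullet> n = 1" using n by (simp add: dot_square_norm)
  have nv: "norm v = 1" using n by (simp add: v_def norm_Theta)
  have vdef: "v = c *\<^sub>R n + s *\<^sub>R (Jmat *v n)"
    by (simp add: v_def Theta_mult c_def s_def)
  have wv: "w \<bullet> v = c * p + s * q"
    by (simp add: vdef inner_simps p_def q_def)
  have vn: "v \<bullet> n = c"
    by (simp add: vdef inner_simps nn inner_commute[of "Jmat *v n" n] inner_Jmat_self)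
  have vJn: "v \<bullet> (Jmat *v n) = s"
    by (simp add: vdef inner_simps nn inner_Jmat_Jmat inner_Jmat_self)
  have D: "0 \<le> D"
    using w norm_ge_zero[of w] by linarith
  have NM: "norm N \<le> M"
  proof -
    have "norm N \<le> norm (N - 2 *\<^sub>R n) + norm (2 *\<^sub>R n)"
      using norm_triangle_ineq[of "N - 2 *\<^sub>R n" "2 *\<^sub>R n"] by simp
    moreover have "b * norm w \<le> b * D" using w b by (rule mult_left_mono)
    ultimately show ?thesis using N n by (simp add: M_def)
  qed
  have cs: "\<bar>u \<bullet> z\<bar> \<le> \<alpha> * \<beta>" if "norm u \<le> \<alpha>" "norm z \<le> \<beta>" for u z :: "real^2" and \<alpha> \<beta>
    using Cauchy_Schwarz_ineq2[of u z] mult_mono[OF that] that(1) norm_ge_zero[of u]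
    by (smt (verit) norm_ge_zero)
  have JN: "norm (Jmat *v (N - 2 *\<^sub>R n)) \<le> b * d"
    using N by (simp add: norm_Jmat d_def)
  have JN_eq: "Jmat *v (N - 2 *\<^sub>R n) = Jmat *v N - 2 *\<^sub>R (Jmat *v n)"
    by (simp add: matrix_vector_mult_diff_distrib matrix_vector_mult_scaleR)
  have P0: "\<bar>P - 2 * p\<bar> \<le> d * (b * d)"
    using cs[of w d "N - 2 *\<^sub>R n" "b * d"] N by (simp add: P_def p_def d_def inner_simps)
  have Q0: "\<bar>Q - 2 * q\<bar> \<le> d * (b * d)"
    using cs[OF _ JN, of w d] by (simp add: JN_eq Q_def q_def d_def inner_simps)
  have A0: "\<bar>A - 2 * c\<bar> \<le> b * d"
    using cs[of v 1 "N - 2 *\<^sub>R n" "b * d"] N nv by (simp add: A_def vn d_def inner_simps)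
  have B0: "\<bar>B - 2 * s\<bar> \<le> b * d"
    using cs[OF _ JN, of v 1] nv by (simp add: JN_eq B_def vJn inner_simps)
  have A1: "\<bar>A\<bar> \<le> M" and B1: "\<bar>B\<bar> \<le> M"
    using cs[of v 1 N M] cs[of v 1 "Jmat *v N" M] nv NM by (auto simp: A_def B_def norm_Jmat)
  have P1: "\<bar>P\<bar> \<le> d * M" and Q1: "\<bar>Q\<bar> \<le> d * M"
    using cs[of w d N M] cs[of w d "Jmat *v N" M] NM by (auto simp: P_def Q_def d_def norm_Jmat)
  have p1: "\<bar>p\<bar> \<le> d" and q1: "\<bar>q\<bar> \<le> d"
    using cs[of w d n 1] cs[of w d "Jmat *v n" 1] n by (auto simp: p_def q_def d_def norm_Jmat)
  have k1: "\<bar>w \<bullet> k\<bar> \<le> d * b" and k2: "\<bar>w \<bullet> (Jmat *v k)\<bar> \<le> d * b"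
    using cs[of w d k b] cs[of w d "Jmat *v k" b] k by (auto simp: d_def norm_Jmat)
  have prod: "\<bar>X * Y\<bar> \<le> \<alpha> * \<beta>" if "\<bar>X\<bar> \<le> \<alpha>" "\<bar>Y\<bar> \<le> \<beta>" for X Y \<alpha> \<beta> :: real
    unfolding abs_mult using that by (intro mult_mono) auto
  have E: "A * Q - 4 * c * q = A * (Q - 2 * q) + 2 * (q * (A - 2 * c))"
    "B * P - 4 * s * p = B * (P - 2 * p) + 2 * (p * (B - 2 * s))"
    by (simp_all add: algebra_simps)
  have R: "(A + w \<bullet> k) * Q + P * (B + w \<bullet> (Jmat *v k)) - 4 * c * q - 4 * s * p
             \<le> 4 * (b * d\<^sup>2 * (M + 1))"
  proof -
    have "A * Q - 4 * c * q \<le> M * (d * (b * d)) + 2 * (d * (b * d))"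
      using prod[OF A1 Q0] prod[OF q1 A0] unfolding E by (simp add: abs_le_iff)
    moreover have "B * P - 4 * s * p \<le> M * (d * (b * d)) + 2 * (d * (b * d))"
      using prod[OF B1 P0] prod[OF p1 B0] unfolding E by (simp add: abs_le_iff)
    moreover have "(w \<bullet> k) * Q \<le> (d * b) * (d * M)"
      using prod[OF k1 Q1] by (simp add: abs_le_iff)
    moreover have "P * (w \<bullet> (Jmat *v k)) \<le> (d * M) * (d * b)"
      using prod[OF P1 k2] by (simp add: abs_le_iff)
    ultimately show ?thesis by (simp add: algebra_simps power2_eq_square)
  qed
  have tan: "tan t = s / c" "0 < tan t"
    using tan_gt_zero[OF t] by (simp_all only: tan_def s_def c_def)
  have double: "cos (2 * t) = c\<^sup>2 - s\<^sup>2" by (simp add: cos_double c_def s_def)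
  have lead: "2 * cos (2 * t) / cos t * p
      = 2 * (c * p + s * q) - 1/2 * tan t * (4 * c * q + 4 * s * p)"
    using c unfolding double tan(1) c_def[symmetric] by (simp add: field_simps power2_eq_square)
  have const: "1/2 * (4 * (b * d\<^sup>2 * (M + 1))) \<le> 6 * (b * (1 + b * D)) * d\<^sup>2"
  proof -
    have "0 \<le> b * d\<^sup>2 * (b * D)" using b D by simp
    then show ?thesis by (simp add: M_def algebra_simps)
  qed
  have "1/2 * ((A + w \<bullet> k) * Q + P * (B + w \<bullet> (Jmat *v k)) - 4 * c * q - 4 * s * p)
          \<le> 6 * (b * (1 + b * D)) * d\<^sup>2"
    using mult_left_mono[OF R, of "1/2"] by (intro order_trans[OF _ const]) simp
  then have "tan t * (1/2 * ((A + w \<bullet> k) * Q + P * (B + w \<bullet> (Jmat *v k)) - 4 * c * q - 4 * s * p))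
          \<le> tan t * (6 * (b * (1 + b * D)) * d\<^sup>2)"
    using tan(2) by (intro mult_left_mono) auto
  then show ?thesis
    unfolding p_def[symmetric] lead wv
    by (simp add: A_def B_def P_def Q_def d_def algebra_simps)
qed

lemma grad_Phi_lower_bound:
  assumes adm: "admissible_domain K \<psi> V a b" and t: "0 < t" "t < pi / 2"
    and x: "x \<in> frontier K" and y: "y \<in> K"
  shows "grad (\<lambda>z. Phi \<psi> t z y) x \<bullet> (Theta t *v grad \<psi> x)
           \<ge> 2 * cos (2 * t) / cos t * ((x - y) \<bullet> grad \<psi> x)
              - 6 * bstar K b * tan t * (norm (x - y))\<^sup>2"
proof -
  have K: "bounded K" "closed K" "K \<subseteq> V" and b: "1 \<le> b" and n: "norm (grad \<psi> x) = 1"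
    using adm x unfolding admissible_domain_def by auto
  have xK: "x \<in> K" using x K(2) by (metis frontier_subset_closed subsetD)
  obtain H where H: "(grad \<psi> has_derivative H) (at x)" "\<And>h. norm (H h) \<le> b * norm h"
    using admissible_domain_hessian[OF adm] xK K(3) by blast
  have "nsum \<psi> x y - 2 *\<^sub>R grad \<psi> x = grad \<psi> y - grad \<psi> x"
    by (simp add: nsum_def scaleR_2)
  then have N: "norm (nsum \<psi> x y - 2 *\<^sub>R grad \<psi> x) \<le> b * norm (x - y)"
    using admissible_domain_grad_lipschitz[OF adm y xK] by (simp add: norm_minus_commute)
  have k: "norm (H (Theta t *v grad \<psi> x)) \<le> b"
    using H(2)[of "Theta t *v grad \<psi> x"] n by (simp add: norm_Theta)
  have w: "norm (x - y) \<le> diameter K"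
    using diameter_bounded_bound[OF K(1) xK y] by (simp add: dist_norm)
  have "0 \<le> b" using b by simp
  from rotated_normal_remainder[OF n N k this w t] show ?thesis
    unfolding inner_grad[OF has_derivative_Phi[OF H(1)]] bstar_def Pfun_def Qfun_def .
qed

theorem lemma4p3:
  "\<exists>c0::real. c0 \<le> 16 \<and>
    (\<forall>(K::(real^2) set) (\<psi>::real^2 \<Rightarrow> real) (V::(real^2) set) (a::real) (b::real)
       (T::real) (\<theta>::real \<Rightarrow> real).
      admissible_domain K \<psi> V a b \<and> admissible_angle T \<theta> \<longrightarrow>
        (\<forall>r\<in>{0..T}. \<forall>x\<in>frontier K. \<forall>y\<in>K.
          grad (\<lambda>z. Phi \<psi> (\<theta> r) z y) x \<bullet> (Theta (\<theta> r) *v grad \<psi> x)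
            \<ge> 2 * cos (2 * \<theta> r) / cos (\<theta> r) * ((x - y) \<bullet> grad \<psi> x)
               - c0 * bstar K b * tan (\<theta> r) * (norm (x - y))\<^sup>2) \<and>
        (\<forall>r\<in>{0..T}. \<forall>y\<in>frontier K. \<forall>x\<in>K.
          grad (\<lambda>z. Phi \<psi> (\<theta> r) x z) y \<bullet> (Theta (\<theta> r) *v grad \<psi> y)
            \<ge> 2 * cos (2 * \<theta> r) / cos (\<theta> r) * ((y - x) \<bullet> grad \<psi> y)
               - c0 * bstar K b * tan (\<theta> r) * (norm (x - y))\<^sup>2))"
proof (intro exI[of _ 6] conjI allI impI ballI)
  show "(6::real) \<le> 16" by simp
next
  fix K :: "(real^2) set" and \<psi> V a b T and \<theta> :: "real \<Rightarrow> real" and r x y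
  assume "admissible_domain K \<psi> V a b \<and> admissible_angle T \<theta>" "r \<in> {0..T}"
    and xy: "x \<in> frontier K" "y \<in> K"
  then have adm: "admissible_domain K \<psi> V a b" and t: "0 < \<theta> r" "\<theta> r < pi / 2"
    unfolding admissible_angle_def by blast+
  show "grad (\<lambda>z. Phi \<psi> (\<theta> r) z y) x \<bullet> (Theta (\<theta> r) *v grad \<psi> x)
      \<ge> 2 * cos (2 * \<theta> r) / cos (\<theta> r) * ((x - y) \<bullet> grad \<psi> x)
         - 6 * bstar K b * tan (\<theta> r) * (norm (x - y))\<^sup>2"
    by (rule grad_Phi_lower_bound[OF adm t xy])
next
  fix K :: "(real^2) set" and \<psi> V a b T and \<theta> :: "real \<Rightarrow> real" and r y x
  assume "admissible_domain K \<psi> V a b \<and> admissible_angle T \<theta>" "r \<in> {0..T}"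
    and yx: "y \<in> frontier K" "x \<in> K"
  then have adm: "admissible_domain K \<psi> V a b" and t: "0 < \<theta> r" "\<theta> r < pi / 2"
    unfolding admissible_angle_def by blast+
  show "grad (\<lambda>z. Phi \<psi> (\<theta> r) x z) y \<bullet> (Theta (\<theta> r) *v grad \<psi> y)
      \<ge> 2 * cos (2 * \<theta> r) / cos (\<theta> r) * ((y - x) \<bullet> grad \<psi> y)
         - 6 * bstar K b * tan (\<theta> r) * (norm (x - y))\<^sup>2"
    using grad_Phi_lower_bound[OF adm t yx]
    by (simp add: Phi_commute[of \<psi> "\<theta> r" x] norm_minus_commute[of x y])
qed

end
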